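(* Let $\mathcal{T}$ be a triangulated category with a metric $\{B_n\}_{n\in\mathbb{N}}$. Let $\{C_n\}_{n\in\mathbb{N}}$ be the improvement of $\{B_n\}_{n\in\mathbb{N}}$. Then $\{C_n\}_{n\in\mathbb{N}}$ is a good metric on $\mathcal{T}$.
   Context: $\mathbb{N}=\{1,2,\dots\}$. All subcategories are full. Let $\mathcal{T}$ be a triangulated category with shift $\Sigma$. For subcategories $\mathcal{X},\mathcal{Z}\subseteq\mathcal{T}$, $\mathcal{X}*\mathcal{Z}$ is the subcategory of all objects $T$ admitting a distinguished triangle $X\to T\to Z\to\Sigma X$ with $X\in\mathcal{X}$, $Z\in\mathcal{Z}$. A metric on $\mathcal{T}$ is a non-increasing chain $B_1\supseteq B_2\supseteq\cdots$ of subcategories of $\mathcal{T}$ with $B_n*B_n=B_n$ and $0\in B_n$ for all $n$. It is good if $\Sigma^{-1}B_{n+1}\cup B_{n+1}\cup\Sigma B_{n+1}\subseteq B_n$ for all $n$. The improvement of a metric $\{B_n\}$ is the sequence $\{C_n\}$ of subcategories defined by $C_1:=B_1$ and $C_n:=B_n\cap\Sigma C_{n-1}\cap\Sigma^{-1}C_{n-1}$ for $n>1$. *)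

theory Defs
  imports "HOL-Algebra.Group"
begin

section \<open>Categories\<close>

record ('o, 'm) category_data =
  Ob :: "'o set"
  Mor :: "'m set"
  Dom :: "'m \<Rightarrow> 'o"
  Cod :: "'m \<Rightarrow> 'o"
  Ident :: "'o \<Rightarrow> 'm"
  Comp :: "'m \<Rightarrow> 'm \<Rightarrow> 'm"  (infixl "\<cdot>\<index>" 70)

definition Hom :: "('o, 'm, 'z) category_data_scheme \<Rightarrow> 'o \<Rightarrow> 'o \<Rightarrow> 'm set" where
  "Hom T X Y = {f \<in> Mor T. Dom T f = X \<and> Cod T f = Y}"

locale category =
  fixes T (structure)
  assumes Dom_Ob: "f \<in> Mor T \<Longrightarrow> Dom T f \<in> Ob T"
    and Cod_Ob: "f \<in> Mor T \<Longrightarrow> Cod T f \<in> Ob T"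
    and Ident_Hom: "X \<in> Ob T \<Longrightarrow> Ident T X \<in> Hom T X X"
    and Comp_Hom: "\<lbrakk>f \<in> Hom T X Y; g \<in> Hom T Y Z\<rbrakk> \<Longrightarrow> g \<cdot> f \<in> Hom T X Z"
    and Comp_Ident: "f \<in> Hom T X Y \<Longrightarrow> f \<cdot> Ident T X = f"
    and Ident_Comp: "f \<in> Hom T X Y \<Longrightarrow> Ident T Y \<cdot> f = f"
    and Comp_assoc: "\<lbrakk>f \<in> Hom T W X; g \<in> Hom T X Y; h \<in> Hom T Y Z\<rbrakk>
      \<Longrightarrow> h \<cdot> (g \<cdot> f) = (h \<cdot> g) \<cdot> f"

definition is_iso :: "('o, 'm, 'z) category_data_scheme \<Rightarrow> 'm \<Rightarrow> bool" where
  "is_iso T f \<longleftrightarrow> f \<in> Mor T \<and>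
     (\<exists>g \<in> Hom T (Cod T f) (Dom T f).
        g \<cdot>\<^bsub>T\<^esub> f = Ident T (Dom T f) \<and> f \<cdot>\<^bsub>T\<^esub> g = Ident T (Cod T f))"

definition isomorphic :: "('o, 'm, 'z) category_data_scheme \<Rightarrow> 'o \<Rightarrow> 'o \<Rightarrow> bool" where
  "isomorphic T X Y \<longleftrightarrow> (\<exists>f \<in> Hom T X Y. is_iso T f)"

definition zero_object :: "('o, 'm, 'z) category_data_scheme \<Rightarrow> 'o \<Rightarrow> bool" where
  "zero_object T Z \<longleftrightarrow> Z \<in> Ob T \<and>
     (\<forall>X \<in> Ob T. (\<exists>!f. f \<in> Hom T X Z) \<and> (\<exists>!f. f \<in> Hom T Z X))"

definition endofunctor ::
  "('o, 'm, 'z) category_data_scheme \<Rightarrow> ('o \<Rightarrow> 'o) \<Rightarrow> ('m \<Rightarrow> 'm) \<Rightarrow> bool" where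
  "endofunctor T Fo Fm \<longleftrightarrow>
     (\<forall>X \<in> Ob T. Fo X \<in> Ob T \<and> Fm (Ident T X) = Ident T (Fo X)) \<and>
     (\<forall>X Y. \<forall>f \<in> Hom T X Y. Fm f \<in> Hom T (Fo X) (Fo Y)) \<and>
     (\<forall>X Y Z. \<forall>f \<in> Hom T X Y. \<forall>g \<in> Hom T Y Z. Fm (g \<cdot>\<^bsub>T\<^esub> f) = Fm g \<cdot>\<^bsub>T\<^esub> Fm f)"

definition naturally_isomorphic ::
  "('o, 'm, 'z) category_data_scheme \<Rightarrow> ('o \<Rightarrow> 'o) \<Rightarrow> ('m \<Rightarrow> 'm) \<Rightarrow>
     ('o \<Rightarrow> 'o) \<Rightarrow> ('m \<Rightarrow> 'm) \<Rightarrow> bool" where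
  "naturally_isomorphic T Fo Fm Go Gm \<longleftrightarrow>
     (\<exists>\<tau>. (\<forall>X \<in> Ob T. \<tau> X \<in> Hom T (Fo X) (Go X) \<and> is_iso T (\<tau> X)) \<and>
          (\<forall>X Y. \<forall>f \<in> Hom T X Y. \<tau> Y \<cdot>\<^bsub>T\<^esub> Fm f = Gm f \<cdot>\<^bsub>T\<^esub> \<tau> X))"


section \<open>Additive categories\<close>

record ('o, 'm) additive_data = "('o, 'm) category_data" +
  Add :: "'m \<Rightarrow> 'm \<Rightarrow> 'm"  (infixl "\<oplus>\<index>" 65)
  Zero :: "'o \<Rightarrow> 'o \<Rightarrow> 'm"

text \<open>The group of morphisms, written multiplicatively in the library: its product is \<open>Add\<close>.\<close>

definition hom_group ::
  "('o, 'm, 'z) additive_data_scheme \<Rightarrow> 'o \<Rightarrow> 'o \<Rightarrow> 'm monoid" where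
  "hom_group T X Y = \<lparr>carrier = Hom T X Y, mult = Add T, one = Zero T X Y\<rparr>"

definition Neg :: "('o, 'm, 'z) additive_data_scheme \<Rightarrow> 'm \<Rightarrow> 'm" where
  "Neg T f = inv\<^bsub>hom_group T (Dom T f) (Cod T f)\<^esub> f"

definition biproduct ::
  "('o, 'm, 'z) additive_data_scheme \<Rightarrow> 'o \<Rightarrow> 'o \<Rightarrow> 'o \<Rightarrow> bool" where
  "biproduct T X Y P \<longleftrightarrow>
     (\<exists>i \<in> Hom T X P. \<exists>j \<in> Hom T Y P. \<exists>p \<in> Hom T P X. \<exists>q \<in> Hom T P Y.
        p \<cdot>\<^bsub>T\<^esub> i = Ident T X \<and> q \<cdot>\<^bsub>T\<^esub> j = Ident T Y \<and>
        q \<cdot>\<^bsub>T\<^esub> i = Zero T X Y \<and> p \<cdot>\<^bsub>T\<^esub> j = Zero T Y X \<and>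
        (i \<cdot>\<^bsub>T\<^esub> p) \<oplus>\<^bsub>T\<^esub> (j \<cdot>\<^bsub>T\<^esub> q) = Ident T P)"

locale additive_category = category +
  assumes hom_comm_group: "\<lbrakk>X \<in> Ob T; Y \<in> Ob T\<rbrakk> \<Longrightarrow> comm_group (hom_group T X Y)"
    and Comp_Add_left: "\<lbrakk>f \<in> Hom T X Y; g \<in> Hom T Y Z; h \<in> Hom T Y Z\<rbrakk>
      \<Longrightarrow> (g \<oplus> h) \<cdot> f = (g \<cdot> f) \<oplus> (h \<cdot> f)"
    and Comp_Add_right: "\<lbrakk>f \<in> Hom T X Y; g \<in> Hom T X Y; h \<in> Hom T Y Z\<rbrakk>
      \<Longrightarrow> h \<cdot> (f \<oplus> g) = (h \<cdot> f) \<oplus> (h \<cdot> g)"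
    and ex_zero_object: "\<exists>Z. zero_object T Z"
    and ex_biproduct: "\<lbrakk>X \<in> Ob T; Y \<in> Ob T\<rbrakk> \<Longrightarrow> \<exists>P \<in> Ob T. biproduct T X Y P"


section \<open>Triangulated categories\<close>

text \<open>
  The shift is an additive autoequivalence, together with a quasi-inverse; a strict automorphism
  is the special case in which the two functors are mutually inverse.  As morphisms know their
  domain and codomain, a triangle is recorded by its three morphisms.
\<close>

record ('o, 'm) triangulated_data = "('o, 'm) additive_data" +
  Shift :: "'o \<Rightarrow> 'o"
  ShiftM :: "'m \<Rightarrow> 'm"
  Unshift :: "'o \<Rightarrow> 'o"
  UnshiftM :: "'m \<Rightarrow> 'm"
  Dist :: "('m \<times> 'm \<times> 'm) set"

definition triangle ::
  "('o, 'm, 'z) triangulated_data_scheme \<Rightarrow> 'm \<times> 'm \<times> 'm \<Rightarrow> bool" where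
  "triangle T = (\<lambda>(f, g, h). \<exists>X Y Z.
     f \<in> Hom T X Y \<and> g \<in> Hom T Y Z \<and> h \<in> Hom T Z (Shift T X))"

definition triangle_morphism ::
  "('o, 'm, 'z) triangulated_data_scheme \<Rightarrow> 'm \<times> 'm \<times> 'm \<Rightarrow> 'm \<times> 'm \<times> 'm \<Rightarrow>
     'm \<Rightarrow> 'm \<Rightarrow> 'm \<Rightarrow> bool" where
  "triangle_morphism T = (\<lambda>(f, g, h) (f', g', h') a b c.
     a \<in> Hom T (Dom T f) (Dom T f') \<and>
     b \<in> Hom T (Dom T g) (Dom T g') \<and>
     c \<in> Hom T (Dom T h) (Dom T h') \<and>
     b \<cdot>\<^bsub>T\<^esub> f = f' \<cdot>\<^bsub>T\<^esub> a \<and> c \<cdot>\<^bsub>T\<^esub> g = g' \<cdot>\<^bsub>T\<^esub> b \<and> ShiftM T a \<cdot>\<^bsub>T\<^esub> h = h' \<cdot>\<^bsub>T\<^esub> c)"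

locale triangulated_category = additive_category +
  assumes Shift_functor: "endofunctor T (Shift T) (ShiftM T)"
    and Shift_Add: "\<lbrakk>f \<in> Hom T X Y; g \<in> Hom T X Y\<rbrakk>
      \<Longrightarrow> ShiftM T (f \<oplus> g) = ShiftM T f \<oplus> ShiftM T g"
    and Unshift_functor: "endofunctor T (Unshift T) (UnshiftM T)"
    and Shift_Unshift: "naturally_isomorphic T
      (Shift T \<circ> Unshift T) (ShiftM T \<circ> UnshiftM T) id id"
    and Unshift_Shift: "naturally_isomorphic T
      (Unshift T \<circ> Shift T) (UnshiftM T \<circ> ShiftM T) id id"
    and Dist_triangle: "t \<in> Dist T \<Longrightarrow> triangle T t"
    and TR1_iso: "\<lbrakk>t \<in> Dist T; triangle T t'; triangle_morphism T t t' a b c;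
        is_iso T a; is_iso T b; is_iso T c\<rbrakk> \<Longrightarrow> t' \<in> Dist T"
    and TR1_Ident: "\<lbrakk>X \<in> Ob T; zero_object T Z\<rbrakk>
      \<Longrightarrow> (Ident T X, Zero T X Z, Zero T Z (Shift T X)) \<in> Dist T"
    and TR1_cone: "f \<in> Mor T \<Longrightarrow> \<exists>g h. (f, g, h) \<in> Dist T"
    and TR2: "triangle T (f, g, h)
      \<Longrightarrow> (f, g, h) \<in> Dist T \<longleftrightarrow> (g, h, Neg T (ShiftM T f)) \<in> Dist T"
    and TR3: "\<lbrakk>(f, g, h) \<in> Dist T; (f', g', h') \<in> Dist T;
        a \<in> Hom T (Dom T f) (Dom T f'); b \<in> Hom T (Cod T f) (Cod T f');
        b \<cdot> f = f' \<cdot> a\<rbrakk>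
      \<Longrightarrow> \<exists>c. triangle_morphism T (f, g, h) (f', g', h') a b c"
    and TR4: "\<lbrakk>f \<in> Hom T X Y; g \<in> Hom T Y Z;
        (f, p, p') \<in> Dist T; (g, q, q') \<in> Dist T; (g \<cdot> f, r, r') \<in> Dist T\<rbrakk>
      \<Longrightarrow> \<exists>u v. (u, v, ShiftM T p \<cdot> q') \<in> Dist T \<and>
             u \<in> Hom T (Cod T p) (Cod T r) \<and> v \<in> Hom T (Cod T r) (Cod T q) \<and>
             u \<cdot> p = r \<cdot> g \<and> v \<cdot> r = q \<and> r' \<cdot> u = p' \<and> q' \<cdot> v = ShiftM T f \<cdot> r'"


section \<open>Metrics\<close>

text \<open>
  A full subcategory is given by its set of objects.  Images of subcategories under the functors
  \<open>\<Sigma>\<close> and \<open>\<Sigma>\<^sup>-\<^sup>1\<close> are essential images, as is usual when \<open>\<Sigma>\<close> is only an equivalence; for an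
  automorphism \<open>\<Sigma>\<close> and an isomorphism-closed subcategory these are the strict images.  The
  subcategories \<open>B\<^sub>n\<close> of a metric are isomorphism-closed because \<open>B\<^sub>n * B\<^sub>n = B\<^sub>n\<close>.
\<close>

definition shift_image :: "('o, 'm, 'z) triangulated_data_scheme \<Rightarrow> 'o set \<Rightarrow> 'o set" where
  "shift_image T S = {X \<in> Ob T. \<exists>Y \<in> S. isomorphic T X (Shift T Y)}"

definition unshift_image :: "('o, 'm, 'z) triangulated_data_scheme \<Rightarrow> 'o set \<Rightarrow> 'o set" where
  "unshift_image T S = {X \<in> Ob T. \<exists>Y \<in> S. isomorphic T X (Unshift T Y)}"

definition ext_product ::
  "('o, 'm, 'z) triangulated_data_scheme \<Rightarrow> 'o set \<Rightarrow> 'o set \<Rightarrow> 'o set" where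
  "ext_product T S S' = {E. \<exists>X \<in> S. \<exists>Z \<in> S'. \<exists>f g h.
     f \<in> Hom T X E \<and> g \<in> Hom T E Z \<and> h \<in> Hom T Z (Shift T X) \<and> (f, g, h) \<in> Dist T}"

text \<open>Sequences are indexed by \<open>n \<ge> 1\<close>; their value at \<open>0\<close> is irrelevant.\<close>

definition metric ::
  "('o, 'm, 'z) triangulated_data_scheme \<Rightarrow> (nat \<Rightarrow> 'o set) \<Rightarrow> bool" where
  "metric T B \<longleftrightarrow> (\<forall>n \<ge> 1. B n \<subseteq> Ob T \<and> B (n + 1) \<subseteq> B n \<and>
     ext_product T (B n) (B n) = B n \<and> (\<forall>Z. zero_object T Z \<longrightarrow> Z \<in> B n))"

definition good_metric ::
  "('o, 'm, 'z) triangulated_data_scheme \<Rightarrow> (nat \<Rightarrow> 'o set) \<Rightarrow> bool" where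
  "good_metric T B \<longleftrightarrow> metric T B \<and>
     (\<forall>n \<ge> 1. unshift_image T (B (n + 1)) \<union> B (n + 1) \<union> shift_image T (B (n + 1)) \<subseteq> B n)"

fun improvement ::
  "('o, 'm, 'z) triangulated_data_scheme \<Rightarrow> (nat \<Rightarrow> 'o set) \<Rightarrow> nat \<Rightarrow> 'o set" where
  "improvement T B 0 = B 0"
| "improvement T B (Suc 0) = B 1"
| "improvement T B (Suc (Suc n)) =
     B (Suc (Suc n)) \<inter> shift_image T (improvement T B (Suc n))
       \<inter> unshift_image T (improvement T B (Suc n))"

end

theory Submission
  imports Defs
begin

text \<open>
  Everything rests on one closure property.  Call a subcategory extension-closed if it contains
  the zero objects and every extension of its objects.  For such \<open>S\<close> the triangles
  \<open>X \<rightarrow> X \<rightarrow> 0 \<rightarrow> \<Sigma>X\<close> give \<open>S * S = S\<close>, and they also make \<open>S\<close> closed under isomorphism; hence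
  \<open>X\<close> lies in the essential image \<open>\<Sigma>S\<close> iff \<open>\<Sigma>\<^sup>-\<^sup>1X \<in> S\<close>, and in \<open>\<Sigma>\<^sup>-\<^sup>1S\<close> iff \<open>\<Sigma>X \<in> S\<close>.

  The point is that \<open>\<Sigma>S\<close> and \<open>\<Sigma>\<^sup>-\<^sup>1S\<close> are again extension-closed
  (\<open>ext_closed_shift_image\<close>, \<open>ext_closed_unshift_image\<close>).  Three rotations of a triangle
  \<open>(f, g, h)\<close> give \<open>(-\<Sigma>f, -\<Sigma>g, -\<Sigma>h)\<close>, and rotation is an equivalence, so one of the two is
  distinguished iff the other is.  This settles \<open>\<Sigma>\<^sup>-\<^sup>1S\<close>, since \<open>\<Sigma>E\<close> is an extension of \<open>\<Sigma>Z\<close> by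
  \<open>\<Sigma>X\<close> whenever \<open>E\<close> is one of \<open>Z\<close> by \<open>X\<close>.  For \<open>\<Sigma>S\<close> a triangle must be desuspended: it is moved
  along \<open>X \<cong> \<Sigma>\<Sigma>\<^sup>-\<^sup>1X\<close> and its analogues for the other two vertices, and then its maps have the form
  \<open>-\<Sigma>f'\<close>, \<open>-\<Sigma>g'\<close>, \<open>-\<Sigma>h'\<close> because an equivalence is full.

  Extension-closed subcategories are stable under intersection, so by induction every term of the
  improvement is extension-closed.  The chain decreases because \<open>{B\<^sub>n}\<close> does and
  both image operations are monotone.  Finally \<open>C\<^sub>n\<^sub>+\<^sub>1 \<subseteq> \<Sigma>C\<^sub>n \<inter> \<Sigma>\<^sup>-\<^sup>1C\<^sub>n\<close> by
  construction, which is the goodness condition after applying \<open>\<Sigma>\<^sup>-\<^sup>1\<close> and \<open>\<Sigma>\<close>.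
\<close>

section \<open>Isomorphisms and equivalences\<close>

lemma (in category) Hom_Ob:
  assumes "f \<in> Hom T X Y"
  shows "X \<in> Ob T" and "Y \<in> Ob T"
  using assms Dom_Ob Cod_Ob by (auto simp: Hom_def)

lemma (in category) is_isoI:
  assumes "f \<in> Hom T X Y" "g \<in> Hom T Y X" "g \<cdot> f = Ident T X" "f \<cdot> g = Ident T Y"
  shows "is_iso T f"
  using assms by (auto simp: is_iso_def Hom_def)

lemma (in category) is_isoE:
  assumes "is_iso T f" "f \<in> Hom T X Y"
  obtains g where "g \<in> Hom T Y X" "g \<cdot> f = Ident T X" "f \<cdot> g = Ident T Y"
  using assms by (auto simp: is_iso_def Hom_def)

lemma (in category) isomorphicI:
  assumes "f \<in> Hom T X Y" "g \<in> Hom T Y X" "g \<cdot> f = Ident T X" "f \<cdot> g = Ident T Y"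
  shows "isomorphic T X Y"
  using assms is_isoI unfolding isomorphic_def by blast

lemma (in category) isomorphicE:
  assumes "isomorphic T X Y"
  obtains f g where "f \<in> Hom T X Y" "g \<in> Hom T Y X" "g \<cdot> f = Ident T X" "f \<cdot> g = Ident T Y"
  using assms is_isoE unfolding isomorphic_def by metis

lemma (in category) isomorphic_refl: "X \<in> Ob T \<Longrightarrow> isomorphic T X X"
  using isomorphicI[OF Ident_Hom Ident_Hom] Comp_Ident[OF Ident_Hom] by blast

lemma (in category) isomorphic_sym: "isomorphic T X Y \<Longrightarrow> isomorphic T Y X"
  by (meson isomorphicE isomorphicI)

lemma (in category) isomorphic_trans:
  assumes "isomorphic T X Y" "isomorphic T Y Z"
  shows "isomorphic T X Z"
proof -
  obtain f f' where f: "f \<in> Hom T X Y" "f' \<in> Hom T Y X" "f' \<cdot> f = Ident T X" "f \<cdot> f' = Ident T Y"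
    using assms(1) isomorphicE by blast
  obtain g g' where g: "g \<in> Hom T Y Z" "g' \<in> Hom T Z Y" "g' \<cdot> g = Ident T Y" "g \<cdot> g' = Ident T Z"
    using assms(2) isomorphicE by blast
  have gf: "g \<cdot> f \<in> Hom T X Z" and fg: "f' \<cdot> g' \<in> Hom T Z X"
    using Comp_Hom[OF f(1) g(1)] Comp_Hom[OF g(2) f(2)] .
  have "(f' \<cdot> g') \<cdot> (g \<cdot> f) = f' \<cdot> ((g' \<cdot> g) \<cdot> f)"
    using Comp_assoc[OF gf g(2) f(2)] Comp_assoc[OF f(1) g(1) g(2)] by simp
  moreover have "(g \<cdot> f) \<cdot> (f' \<cdot> g') = g \<cdot> ((f \<cdot> f') \<cdot> g')"
    using Comp_assoc[OF fg f(1) g(1)] Comp_assoc[OF g(2) f(2) f(1)] by simp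
  ultimately show ?thesis
    using isomorphicI[OF gf fg] f g by (simp add: Ident_Comp)
qed

lemma zero_object_Hom_unique:
  assumes "zero_object T Z" "X \<in> Ob T"
  shows "f \<in> Hom T X Z \<Longrightarrow> g \<in> Hom T X Z \<Longrightarrow> f = g"
    and "f \<in> Hom T Z X \<Longrightarrow> g \<in> Hom T Z X \<Longrightarrow> f = g"
  using assms unfolding zero_object_def by blast+

lemma (in category) isomorphic_zero_objects:
  assumes "zero_object T Z" "zero_object T Z'"
  shows "isomorphic T Z Z'"
proof -
  have Ob: "Z \<in> Ob T" "Z' \<in> Ob T"
    using assms unfolding zero_object_def by blast+
  obtain f where f: "f \<in> Hom T Z Z'"
    using assms(1) Ob(2) unfolding zero_object_def by blast
  obtain g where g: "g \<in> Hom T Z' Z"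
    using assms(1) Ob(2) unfolding zero_object_def by blast
  show ?thesis
    using f g zero_object_Hom_unique(1)[OF assms(1) Ob(1) Comp_Hom[OF f g] Ident_Hom[OF Ob(1)]]
      zero_object_Hom_unique(1)[OF assms(2) Ob(2) Comp_Hom[OF g f] Ident_Hom[OF Ob(2)]]
    by (rule isomorphicI)
qed

lemma endofunctorD:
  assumes "endofunctor T Fo Fm"
  shows "X \<in> Ob T \<Longrightarrow> Fo X \<in> Ob T"
    and "X \<in> Ob T \<Longrightarrow> Fm (Ident T X) = Ident T (Fo X)"
    and "f \<in> Hom T X Y \<Longrightarrow> Fm f \<in> Hom T (Fo X) (Fo Y)"
    and "\<lbrakk>f \<in> Hom T X Y; g \<in> Hom T Y Z\<rbrakk> \<Longrightarrow> Fm (g \<cdot>\<^bsub>T\<^esub> f) = Fm g \<cdot>\<^bsub>T\<^esub> Fm f"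
  using assms unfolding endofunctor_def by blast+

lemma (in category) endofunctor_isomorphic:
  assumes F: "endofunctor T Fo Fm" and "isomorphic T X Y"
  shows "isomorphic T (Fo X) (Fo Y)"
proof -
  obtain f g where fg: "f \<in> Hom T X Y" "g \<in> Hom T Y X" "g \<cdot> f = Ident T X" "f \<cdot> g = Ident T Y"
    using assms(2) isomorphicE by blast
  then have "Fm g \<cdot> Fm f = Ident T (Fo X)" "Fm f \<cdot> Fm g = Ident T (Fo Y)"
    using endofunctorD(4)[OF F fg(1,2)] endofunctorD(4)[OF F fg(2,1)]
      endofunctorD(2)[OF F] Hom_Ob[OF fg(1)] by simp_all
  then show ?thesis
    using fg endofunctorD(3)[OF F] isomorphicI by blast
qed

lemma naturally_isomorphic_identityE:
  assumes "naturally_isomorphic T Fo Fm id id"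
  obtains \<tau> where "\<And>X. X \<in> Ob T \<Longrightarrow> \<tau> X \<in> Hom T (Fo X) X"
    and "\<And>X. X \<in> Ob T \<Longrightarrow> is_iso T (\<tau> X)"
    and "\<And>X Y f. f \<in> Hom T X Y \<Longrightarrow> \<tau> Y \<cdot>\<^bsub>T\<^esub> Fm f = f \<cdot>\<^bsub>T\<^esub> \<tau> X"
  using assms unfolding naturally_isomorphic_def id_apply by blast

lemma (in category) naturally_isomorphic_identity_faithful:
  assumes "naturally_isomorphic T Fo Fm id id"
    and f: "f \<in> Hom T X Y" and g: "g \<in> Hom T X Y" and "Fm f = Fm g"
  shows "f = g"
proof -
  obtain \<tau> where \<tau>: "\<And>X. X \<in> Ob T \<Longrightarrow> \<tau> X \<in> Hom T (Fo X) X"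
      "\<And>X. X \<in> Ob T \<Longrightarrow> is_iso T (\<tau> X)"
    and nat: "\<And>X Y f. f \<in> Hom T X Y \<Longrightarrow> \<tau> Y \<cdot> Fm f = f \<cdot> \<tau> X"
    by (rule naturally_isomorphic_identityE[OF assms(1)]) blast
  have X: "X \<in> Ob T" using f Hom_Ob by blast
  obtain s where s: "s \<in> Hom T X (Fo X)" "\<tau> X \<cdot> s = Ident T X"
    using is_isoE[OF \<tau>(2)[OF X] \<tau>(1)[OF X]] by blast
  have "f \<cdot> \<tau> X = g \<cdot> \<tau> X"
    using nat[OF f] nat[OF g] assms(4) by simp
  then have "f \<cdot> (\<tau> X \<cdot> s) = g \<cdot> (\<tau> X \<cdot> s)"
    using \<tau>(1)[OF X] Comp_assoc[OF s(1) _ f] Comp_assoc[OF s(1) _ g] by simp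
  then show ?thesis using s f g Comp_Ident by simp
qed

lemma (in category) naturally_isomorphic_identity_isomorphic:
  assumes "naturally_isomorphic T Fo Fm id id" "X \<in> Ob T"
  shows "isomorphic T (Fo X) X"
proof -
  obtain \<tau> where "\<tau> \<in> Hom T (Fo X) X" "is_iso T \<tau>"
    by (rule naturally_isomorphic_identityE[OF assms(1)]) (use assms(2) in blast)
  then show ?thesis unfolding isomorphic_def by blast
qed

text \<open>
  Given \<open>\<phi> : FX \<rightarrow> FY\<close>, transport \<open>G\<phi>\<close> along \<open>GF \<cong> id\<close> to \<open>\<psi> : X \<rightarrow> Y\<close>.  Naturality gives
  \<open>GF\<psi> = G\<phi>\<close>, and \<open>G\<close> is faithful because \<open>FG \<cong> id\<close>.
\<close>

lemma (in category) equivalence_full: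
  assumes F: "endofunctor T Fo Fm" and G: "endofunctor T Go Gm"
    and FG: "naturally_isomorphic T (Fo \<circ> Go) (Fm \<circ> Gm) id id"
    and GF: "naturally_isomorphic T (Go \<circ> Fo) (Gm \<circ> Fm) id id"
    and X: "X \<in> Ob T" and Y: "Y \<in> Ob T" and \<phi>: "\<phi> \<in> Hom T (Fo X) (Fo Y)"
  obtains \<psi> where "\<psi> \<in> Hom T X Y" "Fm \<psi> = \<phi>"
proof -
  obtain \<eta> where \<eta>: "\<And>X. X \<in> Ob T \<Longrightarrow> \<eta> X \<in> Hom T (Go (Fo X)) X"
      "\<And>X. X \<in> Ob T \<Longrightarrow> is_iso T (\<eta> X)"
    and nat: "\<And>X Y f. f \<in> Hom T X Y \<Longrightarrow> \<eta> Y \<cdot> Gm (Fm f) = f \<cdot> \<eta> X"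
    by (rule naturally_isomorphic_identityE[OF GF, unfolded comp_apply]) blast
  obtain s where s: "s \<in> Hom T X (Go (Fo X))" "s \<cdot> \<eta> X = Ident T (Go (Fo X))"
    using is_isoE[OF \<eta>(2)[OF X] \<eta>(1)[OF X]] by blast
  obtain t where t: "t \<in> Hom T Y (Go (Fo Y))" "t \<cdot> \<eta> Y = Ident T (Go (Fo Y))"
    using is_isoE[OF \<eta>(2)[OF Y] \<eta>(1)[OF Y]] by blast
  have G\<phi>: "Gm \<phi> \<in> Hom T (Go (Fo X)) (Go (Fo Y))"
    using endofunctorD(3)[OF G \<phi>] .
  define \<psi> where "\<psi> = (\<eta> Y \<cdot> Gm \<phi>) \<cdot> s"
  have \<eta>G\<phi>: "\<eta> Y \<cdot> Gm \<phi> \<in> Hom T (Go (Fo X)) Y"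
    using Comp_Hom[OF G\<phi>] \<eta>(1)[OF Y] by blast
  have \<psi>: "\<psi> \<in> Hom T X Y"
    unfolding \<psi>_def using Comp_Hom[OF s(1) \<eta>G\<phi>] .
  have GF\<psi>: "Gm (Fm \<psi>) \<in> Hom T (Go (Fo X)) (Go (Fo Y))"
    using \<psi> endofunctorD(3)[OF F] endofunctorD(3)[OF G] by blast
  have "\<eta> Y \<cdot> Gm (Fm \<psi>) = ((\<eta> Y \<cdot> Gm \<phi>) \<cdot> s) \<cdot> \<eta> X"
    using nat[OF \<psi>] unfolding \<psi>_def .
  also have "\<dots> = (\<eta> Y \<cdot> Gm \<phi>) \<cdot> (s \<cdot> \<eta> X)"
    using Comp_assoc[OF _ s(1) \<eta>G\<phi>] \<eta>(1)[OF X] by simp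
  also have "\<dots> = \<eta> Y \<cdot> Gm \<phi>"
    using s \<eta>G\<phi> Comp_Ident by simp
  finally have "t \<cdot> (\<eta> Y \<cdot> Gm (Fm \<psi>)) = t \<cdot> (\<eta> Y \<cdot> Gm \<phi>)" by simp
  then have "(t \<cdot> \<eta> Y) \<cdot> Gm (Fm \<psi>) = (t \<cdot> \<eta> Y) \<cdot> Gm \<phi>"
    using Comp_assoc[OF GF\<psi> _ t(1)] Comp_assoc[OF G\<phi> _ t(1)] \<eta>(1)[OF Y] by simp
  then have "Gm (Fm \<psi>) = Gm \<phi>"
    using t GF\<psi> G\<phi> Ident_Comp by simp
  then have "Fm \<psi> = \<phi>"
    using naturally_isomorphic_identity_faithful[OF FG endofunctorD(3)[OF F \<psi>] \<phi>] by simp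
  with \<psi> show ?thesis using that by blast
qed


section \<open>Rotating distinguished triangles\<close>

lemma (in additive_category) Zero_Hom:
  assumes "X \<in> Ob T" "Y \<in> Ob T"
  shows "Zero T X Y \<in> Hom T X Y"
proof -
  interpret comm_group "hom_group T X Y" using hom_comm_group assms .
  show ?thesis using one_closed by (simp add: hom_group_def)
qed

lemma (in additive_category) Neg_Hom:
  assumes f: "f \<in> Hom T X Y"
  shows "Neg T f \<in> Hom T X Y"
proof -
  interpret comm_group "hom_group T X Y" using hom_comm_group Hom_Ob[OF f] .
  have "Dom T f = X" "Cod T f = Y" using f by (auto simp: Hom_def)
  then show ?thesis using inv_closed[of f] f by (simp add: hom_group_def Neg_def)
qed

lemma (in additive_category) Neg_Neg:
  assumes f: "f \<in> Hom T X Y"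
  shows "Neg T (Neg T f) = f"
proof -
  interpret comm_group "hom_group T X Y" using hom_comm_group Hom_Ob[OF f] .
  have "Dom T f = X" "Cod T f = Y" "Dom T (Neg T f) = X" "Cod T (Neg T f) = Y"
    using f Neg_Hom[OF f] by (auto simp: Hom_def)
  then show ?thesis using inv_inv[of f] f by (simp add: hom_group_def Neg_def)
qed

lemma (in additive_category) Hom_add_idem_imp_Zero:
  assumes f: "f \<in> Hom T X Y" and "f \<oplus> f = f"
  shows "f = Zero T X Y"
proof -
  interpret comm_group "hom_group T X Y" using hom_comm_group Hom_Ob[OF f] .
  show ?thesis using r_cancel_one'[of f f] f assms(2) by (simp add: hom_group_def)
qed

lemma (in additive_category) Add_Hom:
  assumes f: "f \<in> Hom T X Y" and g: "g \<in> Hom T X Y"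
  shows "f \<oplus> g \<in> Hom T X Y"
proof -
  interpret comm_group "hom_group T X Y" using hom_comm_group Hom_Ob[OF f] .
  show ?thesis using m_closed[of f g] f g by (simp add: hom_group_def)
qed

text \<open>
  A vanishing identity makes every morphism into or out of \<open>Z\<close> factor through \<open>0 : Z \<rightarrow> Z\<close>, and
  composites with \<open>0\<close> vanish since they are idempotent for addition.
\<close>

lemma (in additive_category) zero_object_if_Ident_Zero:
  assumes Z: "Z \<in> Ob T" and "Ident T Z = Zero T Z Z"
  shows "zero_object T Z"
proof -
  have I: "Ident T Z \<in> Hom T Z Z" using Ident_Hom Z .
  interpret comm_group "hom_group T Z Z" using hom_comm_group Z Z .
  have dbl: "Ident T Z \<oplus> Ident T Z = Ident T Z"
    using l_one[of "Ident T Z"] I assms(2) by (simp add: hom_group_def)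
  have "f = Zero T X Z" if f: "f \<in> Hom T X Z" for X f
    using Hom_add_idem_imp_Zero[OF f] Comp_Add_left[OF f I I] Ident_Comp[OF f] dbl by simp
  moreover have "f = Zero T Z X" if f: "f \<in> Hom T Z X" for X f
    using Hom_add_idem_imp_Zero[OF f] Comp_Add_right[OF I I f] Comp_Ident[OF f] dbl by simp
  ultimately show ?thesis
    using Z Zero_Hom[OF Z] Zero_Hom[OF _ Z] unfolding zero_object_def by blast
qed

lemma triangleI:
  assumes "f \<in> Hom T X Y" "g \<in> Hom T Y Z" "h \<in> Hom T Z (Shift T X)"
  shows "triangle T (f, g, h)"
  using assms by (auto simp: triangle_def)

context triangulated_category
begin

lemmas Shift_Ob = endofunctorD(1)[OF Shift_functor]
lemmas Shift_Hom = endofunctorD(3)[OF Shift_functor]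
lemmas Unshift_Ob = endofunctorD(1)[OF Unshift_functor]

lemma Shift_Unshift_isomorphic: "X \<in> Ob T \<Longrightarrow> isomorphic T (Shift T (Unshift T X)) X"
  using naturally_isomorphic_identity_isomorphic[OF Shift_Unshift] by simp

lemma Unshift_Shift_isomorphic: "X \<in> Ob T \<Longrightarrow> isomorphic T (Unshift T (Shift T X)) X"
  using naturally_isomorphic_identity_isomorphic[OF Unshift_Shift] by simp

lemma Shift_isomorphic: "isomorphic T X Y \<Longrightarrow> isomorphic T (Shift T X) (Shift T Y)"
  using endofunctor_isomorphic[OF Shift_functor] .

lemma Unshift_isomorphic: "isomorphic T X Y \<Longrightarrow> isomorphic T (Unshift T X) (Unshift T Y)"
  using endofunctor_isomorphic[OF Unshift_functor] .

lemma Neg_Shift_surj: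
  assumes "X \<in> Ob T" "Y \<in> Ob T" "\<phi> \<in> Hom T (Shift T X) (Shift T Y)"
  obtains \<psi> where "\<psi> \<in> Hom T X Y" "Neg T (ShiftM T \<psi>) = \<phi>"
proof -
  obtain \<psi> where "\<psi> \<in> Hom T X Y" "ShiftM T \<psi> = Neg T \<phi>"
    by (rule equivalence_full[OF Shift_functor Unshift_functor Shift_Unshift Unshift_Shift
      assms(1,2) Neg_Hom[OF assms(3)]])
  then show ?thesis using that Neg_Neg[OF assms(3)] by simp
qed

lemma zero_object_Shift:
  assumes Z: "zero_object T Z"
  shows "zero_object T (Shift T Z)"
proof -
  have Ob: "Z \<in> Ob T" using Z by (simp add: zero_object_def)
  have I: "Ident T Z \<in> Hom T Z Z" using Ident_Hom[OF Ob] .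
  have "Ident T Z \<oplus> Ident T Z = Ident T Z"
    using zero_object_Hom_unique(1)[OF Z Ob Add_Hom[OF I I] I] .
  then have "Ident T (Shift T Z) \<oplus> Ident T (Shift T Z) = Ident T (Shift T Z)"
    using Shift_Add[OF I I] endofunctorD(2)[OF Shift_functor Ob] by simp
  then show ?thesis
    using Hom_add_idem_imp_Zero[OF Ident_Hom[OF Shift_Ob[OF Ob]]]
      zero_object_if_Ident_Zero[OF Shift_Ob[OF Ob]] by simp
qed

text \<open>
  Rotating three times.  The signs are harmless: extension-closure only sees the vertices.
\<close>

lemma Dist_iff_Dist_Shift:
  assumes f: "f \<in> Hom T X Y" and g: "g \<in> Hom T Y Z" and h: "h \<in> Hom T Z (Shift T X)"
  shows "(f, g, h) \<in> Dist T \<longleftrightarrow>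
    (Neg T (ShiftM T f), Neg T (ShiftM T g), Neg T (ShiftM T h)) \<in> Dist T"
proof -
  have f': "Neg T (ShiftM T f) \<in> Hom T (Shift T X) (Shift T Y)"
    and g': "Neg T (ShiftM T g) \<in> Hom T (Shift T Y) (Shift T Z)"
    using f g Shift_Hom Neg_Hom by blast+
  show ?thesis
    using TR2[OF triangleI[OF f g h]] TR2[OF triangleI[OF g h f']] TR2[OF triangleI[OF h f' g']]
    by simp
qed

text \<open>
  The last map is transported along \<open>\<Sigma>a\<close> and not along a fourth isomorphism, so the outcome is a
  triangle again.
\<close>

lemma Dist_transport:
  assumes D: "(f, g, h) \<in> Dist T"
    and f: "f \<in> Hom T X Y" and g: "g \<in> Hom T Y Z" and h: "h \<in> Hom T Z (Shift T X)"
    and "isomorphic T X X'" "isomorphic T Y Y'" "isomorphic T Z Z'"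
  obtains f' g' h' where "f' \<in> Hom T X' Y'" "g' \<in> Hom T Y' Z'" "h' \<in> Hom T Z' (Shift T X')"
    "(f', g', h') \<in> Dist T"
proof -
  obtain a a' where a: "a \<in> Hom T X X'" "a' \<in> Hom T X' X" "a' \<cdot> a = Ident T X" "a \<cdot> a' = Ident T X'"
    by (rule isomorphicE[OF assms(5)])
  obtain b b' where b: "b \<in> Hom T Y Y'" "b' \<in> Hom T Y' Y" "b' \<cdot> b = Ident T Y" "b \<cdot> b' = Ident T Y'"
    by (rule isomorphicE[OF assms(6)])
  obtain c c' where c: "c \<in> Hom T Z Z'" "c' \<in> Hom T Z' Z" "c' \<cdot> c = Ident T Z" "c \<cdot> c' = Ident T Z'"
    by (rule isomorphicE[OF assms(7)])
  have conj: "(v \<cdot> k) \<cdot> u' \<in> Hom T U' V'" "((v \<cdot> k) \<cdot> u') \<cdot> u = v \<cdot> k"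
    if "k \<in> Hom T U V" "v \<in> Hom T V V'" "u \<in> Hom T U U'" "u' \<in> Hom T U' U" "u' \<cdot> u = Ident T U"
    for k u u' v U V U' V'
  proof -
    have vk: "v \<cdot> k \<in> Hom T U V'" using Comp_Hom that by blast
    show "(v \<cdot> k) \<cdot> u' \<in> Hom T U' V'" using Comp_Hom[OF that(4) vk] .
    show "((v \<cdot> k) \<cdot> u') \<cdot> u = v \<cdot> k"
      using Comp_assoc[OF that(3,4) vk] that(5) Comp_Ident[OF vk] by simp
  qed
  have Sa: "ShiftM T a \<in> Hom T (Shift T X) (Shift T X')" using Shift_Hom a(1) .
  let ?f = "(b \<cdot> f) \<cdot> a'" and ?g = "(c \<cdot> g) \<cdot> b'" and ?h = "(ShiftM T a \<cdot> h) \<cdot> c'"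
  note F = conj[OF f b(1) a(1,2,3)]
  note G = conj[OF g c(1) b(1,2,3)]
  note H = conj[OF h Sa c(1,2,3)]
  have "triangle_morphism T (f, g, h) (?f, ?g, ?h) a b c"
    using F G H f g h a b c unfolding triangle_morphism_def Hom_def by simp
  then have "(?f, ?g, ?h) \<in> Dist T"
    using TR1_iso[OF D triangleI[OF F(1) G(1) H(1)]] is_isoI[OF a] is_isoI[OF b] is_isoI[OF c]
    by blast
  then show ?thesis using that F(1) G(1) H(1) by blast
qed

end


section \<open>Extension-closed subcategories\<close>

definition ext_closed :: "('o, 'm, 'z) triangulated_data_scheme \<Rightarrow> 'o set \<Rightarrow> bool" where
  "ext_closed T S \<longleftrightarrow>
     S \<subseteq> Ob T \<and> ext_product T S S \<subseteq> S \<and> (\<forall>Z. zero_object T Z \<longrightarrow> Z \<in> S)"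

lemma ext_closed_Int: "ext_closed T S \<Longrightarrow> ext_closed T S' \<Longrightarrow> ext_closed T (S \<inter> S')"
  unfolding ext_closed_def ext_product_def by blast

lemma ext_closedI:
  assumes "S \<subseteq> Ob T" "\<And>Z. zero_object T Z \<Longrightarrow> Z \<in> S"
    and "\<And>X E Z f g h. \<lbrakk>X \<in> S; Z \<in> S; f \<in> Hom T X E; g \<in> Hom T E Z; h \<in> Hom T Z (Shift T X);
      (f, g, h) \<in> Dist T\<rbrakk> \<Longrightarrow> E \<in> S"
  shows "ext_closed T S"
  using assms(1,2) unfolding ext_closed_def ext_product_def by (auto intro: assms(3))

lemma ext_closedD:
  assumes "ext_closed T S" "(f, g, h) \<in> Dist T"
    and "f \<in> Hom T X E" "g \<in> Hom T E Z" "h \<in> Hom T Z (Shift T X)" "X \<in> S" "Z \<in> S"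
  shows "E \<in> S"
  using assms unfolding ext_closed_def ext_product_def by blast

context triangulated_category
begin

text \<open>
  Transporting \<open>X \<rightarrow> X \<rightarrow> 0 \<rightarrow> \<Sigma>X\<close> along \<open>X \<cong> Y\<close> in the middle vertex only.  This yields both
  \<open>S \<subseteq> S * S\<close> and closure under isomorphism.
\<close>

lemma isomorphic_in_ext_product:
  assumes X: "X \<in> S" "X \<in> Ob T" and S': "\<And>Z. zero_object T Z \<Longrightarrow> Z \<in> S'"
    and XY: "isomorphic T X Y"
  shows "Y \<in> ext_product T S S'"
proof -
  obtain Z where Z: "zero_object T Z" using ex_zero_object by blast
  then have ZOb: "Z \<in> Ob T" by (simp add: zero_object_def)
  obtain f g h where "f \<in> Hom T X Y" "g \<in> Hom T Y Z" "h \<in> Hom T Z (Shift T X)"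
    "(f, g, h) \<in> Dist T"
    using Dist_transport[OF TR1_Ident[OF X(2) Z] Ident_Hom[OF X(2)] Zero_Hom[OF X(2) ZOb]
        Zero_Hom[OF ZOb Shift_Ob[OF X(2)]] isomorphic_refl[OF X(2)] XY isomorphic_refl[OF ZOb]]
    by blast
  then show ?thesis using X(1) S'[OF Z] unfolding ext_product_def by blast
qed

lemma ext_closed_isomorphic:
  assumes "ext_closed T S" "X \<in> S" "isomorphic T X Y"
  shows "Y \<in> S"
  using isomorphic_in_ext_product[of X S S Y] assms unfolding ext_closed_def by blast

lemma ext_closed_ext_product:
  assumes "ext_closed T S"
  shows "ext_product T S S = S"
  using isomorphic_in_ext_product[of _ S S] isomorphic_refl assms unfolding ext_closed_def by blast

lemma mem_shift_image_iff:
  assumes S: "ext_closed T S"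
  shows "X \<in> shift_image T S \<longleftrightarrow> X \<in> Ob T \<and> Unshift T X \<in> S"
proof
  assume "X \<in> shift_image T S"
  then obtain Y where Y: "X \<in> Ob T" "Y \<in> S" "isomorphic T X (Shift T Y)"
    unfolding shift_image_def by blast
  have "Y \<in> Ob T" using S Y unfolding ext_closed_def by blast
  then have "isomorphic T (Unshift T X) Y"
    using isomorphic_trans[OF Unshift_isomorphic[OF Y(3)] Unshift_Shift_isomorphic] by blast
  then show "X \<in> Ob T \<and> Unshift T X \<in> S"
    using Y ext_closed_isomorphic[OF S] isomorphic_sym by blast
next
  assume "X \<in> Ob T \<and> Unshift T X \<in> S"
  then show "X \<in> shift_image T S"
    using isomorphic_sym[OF Shift_Unshift_isomorphic] unfolding shift_image_def by blast
qed

lemma mem_unshift_image_iff: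
  assumes S: "ext_closed T S"
  shows "X \<in> unshift_image T S \<longleftrightarrow> X \<in> Ob T \<and> Shift T X \<in> S"
proof
  assume "X \<in> unshift_image T S"
  then obtain Y where Y: "X \<in> Ob T" "Y \<in> S" "isomorphic T X (Unshift T Y)"
    unfolding unshift_image_def by blast
  have "Y \<in> Ob T" using S Y unfolding ext_closed_def by blast
  then have "isomorphic T (Shift T X) Y"
    using isomorphic_trans[OF Shift_isomorphic[OF Y(3)] Shift_Unshift_isomorphic] by blast
  then show "X \<in> Ob T \<and> Shift T X \<in> S"
    using Y ext_closed_isomorphic[OF S] isomorphic_sym by blast
next
  assume "X \<in> Ob T \<and> Shift T X \<in> S"
  then show "X \<in> unshift_image T S"
    using isomorphic_sym[OF Unshift_Shift_isomorphic] unfolding unshift_image_def by blast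
qed

text \<open>
  If \<open>(f, g, h)\<close> exhibits \<open>E\<close> as an extension of \<open>Z\<close> by \<open>X\<close>, then \<open>(-\<Sigma>f, -\<Sigma>g, -\<Sigma>h)\<close> exhibits
  \<open>\<Sigma>E\<close> as an extension of \<open>\<Sigma>Z\<close> by \<open>\<Sigma>X\<close>, both of which lie in \<open>S\<close>.
\<close>

lemma ext_closed_unshift_image:
  assumes S: "ext_closed T S"
  shows "ext_closed T (unshift_image T S)"
proof (rule ext_closedI)
  show "unshift_image T S \<subseteq> Ob T" by (auto simp: unshift_image_def)
next
  show "E \<in> unshift_image T S"
    if X: "X \<in> unshift_image T S" and Z: "Z \<in> unshift_image T S"
      and f: "f \<in> Hom T X E" and g: "g \<in> Hom T E Z" and h: "h \<in> Hom T Z (Shift T X)"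
      and D: "(f, g, h) \<in> Dist T" for X E Z f g h
  proof -
    have "Shift T E \<in> S"
      using ext_closedD[OF S Dist_iff_Dist_Shift[OF f g h, THEN iffD1, OF D]
          Neg_Hom[OF Shift_Hom[OF f]] Neg_Hom[OF Shift_Hom[OF g]] Neg_Hom[OF Shift_Hom[OF h]]]
        X Z by (simp add: mem_unshift_image_iff[OF S])
    then show ?thesis using mem_unshift_image_iff[OF S] Hom_Ob(2)[OF f] by blast
  qed
  show "Z \<in> unshift_image T S" if "zero_object T Z" for Z
  proof -
    have "Z \<in> Ob T" using that by (simp add: zero_object_def)
    moreover have "Shift T Z \<in> S"
      using S zero_object_Shift[OF that] by (simp add: ext_closed_def)
    ultimately show ?thesis using mem_unshift_image_iff[OF S] by blast
  qed
qed

text \<open>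
  Desuspending an extension: the triangle is replaced by an isomorphic one with vertices
  \<open>\<Sigma>\<Sigma>\<^sup>-\<^sup>1X\<close>, \<open>\<Sigma>\<Sigma>\<^sup>-\<^sup>1E\<close>, \<open>\<Sigma>\<Sigma>\<^sup>-\<^sup>1Z\<close>, whose maps come from maps between \<open>\<Sigma>\<^sup>-\<^sup>1X\<close>, \<open>\<Sigma>\<^sup>-\<^sup>1E\<close>, \<open>\<Sigma>\<^sup>-\<^sup>1Z\<close>
  and \<open>\<Sigma>\<Sigma>\<^sup>-\<^sup>1X\<close>.  Lifting along \<open>\<psi> \<mapsto> -\<Sigma>\<psi>\<close> makes the backward rotation apply directly.
\<close>

lemma ext_closed_shift_image:
  assumes S: "ext_closed T S"
  shows "ext_closed T (shift_image T S)"
proof (rule ext_closedI)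
  show "shift_image T S \<subseteq> Ob T" by (auto simp: shift_image_def)
next
  show "E \<in> shift_image T S"
    if X: "X \<in> shift_image T S" and Z: "Z \<in> shift_image T S"
      and f: "f \<in> Hom T X E" and g: "g \<in> Hom T E Z" and h: "h \<in> Hom T Z (Shift T X)"
      and D: "(f, g, h) \<in> Dist T" for X E Z f g h
  proof -
    let ?U = "Unshift T"
    have Ob: "X \<in> Ob T" "E \<in> Ob T" "Z \<in> Ob T"
      using Hom_Ob[OF f] Hom_Ob[OF g] by blast+
    have UOb: "?U X \<in> Ob T" "?U E \<in> Ob T" "?U Z \<in> Ob T"
      using Ob Unshift_Ob by blast+
    obtain f1 g1 h1 where 1: "f1 \<in> Hom T (Shift T (?U X)) (Shift T (?U E))"
      "g1 \<in> Hom T (Shift T (?U E)) (Shift T (?U Z))"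
      "h1 \<in> Hom T (Shift T (?U Z)) (Shift T (Shift T (?U X)))" "(f1, g1, h1) \<in> Dist T"
      by (rule Dist_transport[OF D f g h Ob[THEN Shift_Unshift_isomorphic, THEN isomorphic_sym]])
    obtain f' where f': "f' \<in> Hom T (?U X) (?U E)" "Neg T (ShiftM T f') = f1"
      using Neg_Shift_surj[OF UOb(1,2) 1(1)] .
    obtain g' where g': "g' \<in> Hom T (?U E) (?U Z)" "Neg T (ShiftM T g') = g1"
      using Neg_Shift_surj[OF UOb(2,3) 1(2)] .
    obtain h' where h': "h' \<in> Hom T (?U Z) (Shift T (?U X))" "Neg T (ShiftM T h') = h1"
      using Neg_Shift_surj[OF UOb(3) Shift_Ob[OF UOb(1)] 1(3)] .
    have "(f', g', h') \<in> Dist T"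
      using Dist_iff_Dist_Shift[OF f'(1) g'(1) h'(1)] 1(4) f'(2) g'(2) h'(2) by simp
    from ext_closedD[OF S this f'(1) g'(1) h'(1)] have "?U E \<in> S"
      using X Z
      by (simp add: mem_shift_image_iff[OF S])
    then show ?thesis using mem_shift_image_iff[OF S] Ob(2) by blast
  qed
  \<comment> \<open>\<open>Z \<cong> \<Sigma>Z\<close>, both being zero objects, so \<open>Z\<close> is its own desuspension.\<close>
  show "Z \<in> shift_image T S" if Z: "zero_object T Z" for Z
  proof -
    have "Z \<in> Ob T" using Z by (simp add: zero_object_def)
    moreover have "Z \<in> S" using S Z by (simp add: ext_closed_def)
    ultimately show ?thesis
      using isomorphic_zero_objects[OF Z zero_object_Shift[OF Z]]
      unfolding shift_image_def by blast
  qed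
qed


section \<open>The improvement of a metric\<close>

text \<open>
  The two inclusions below turn \<open>C\<^sub>n\<^sub>+\<^sub>1 \<subseteq> \<Sigma>\<^sup>-\<^sup>1C\<^sub>n\<close> into \<open>\<Sigma>C\<^sub>n\<^sub>+\<^sub>1 \<subseteq> C\<^sub>n\<close>, and dually.
\<close>

lemma shift_image_unshift_image_subset:
  assumes S: "ext_closed T S"
  shows "shift_image T (unshift_image T S) \<subseteq> S"
  using mem_shift_image_iff[OF ext_closed_unshift_image[OF S]] mem_unshift_image_iff[OF S]
    ext_closed_isomorphic[OF S] Shift_Unshift_isomorphic by blast

lemma unshift_image_shift_image_subset:
  assumes S: "ext_closed T S"
  shows "unshift_image T (shift_image T S) \<subseteq> S"
  using mem_unshift_image_iff[OF ext_closed_shift_image[OF S]] mem_shift_image_iff[OF S]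
    ext_closed_isomorphic[OF S] Unshift_Shift_isomorphic by blast

end

lemma metric_ext_closed:
  assumes "metric T B" "n \<ge> 1"
  shows "ext_closed T (B n)"
  using assms unfolding metric_def ext_closed_def by blast

lemma (in triangulated_category) ext_closed_improvement:
  assumes "metric T B"
  shows "ext_closed T (improvement T B (Suc n))"
proof (induction n)
  case 0
  then show ?case using metric_ext_closed[OF assms] by simp
next
  case (Suc n)
  then show ?case
    using metric_ext_closed[OF assms, of "Suc (Suc n)"]
    by (simp add: ext_closed_Int ext_closed_shift_image ext_closed_unshift_image)
qed

lemma shift_image_mono: "S \<subseteq> S' \<Longrightarrow> shift_image T S \<subseteq> shift_image T S'"
  unfolding shift_image_def by blast

lemma unshift_image_mono: "S \<subseteq> S' \<Longrightarrow> unshift_image T S \<subseteq> unshift_image T S'"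
  unfolding unshift_image_def by blast

lemma improvement_decreasing:
  assumes "metric T B"
  shows "improvement T B (Suc (Suc n)) \<subseteq> improvement T B (Suc n)"
proof (induction n)
  case 0
  have "B (1 + 1) \<subseteq> B 1" using assms unfolding metric_def by blast
  then show ?case by auto
next
  case (Suc n)
  have "B (Suc (Suc n) + 1) \<subseteq> B (Suc (Suc n))"
    using assms unfolding metric_def by simp
  then show ?case
    using shift_image_mono[OF Suc, of T] unshift_image_mono[OF Suc, of T]
    by (simp del: improvement.simps add: improvement.simps(3)) blast
qed

theorem proposition5p5:
  fixes T :: "('o, 'm, 'z) triangulated_data_scheme" and B :: "nat \<Rightarrow> 'o set"
  assumes "triangulated_category T"
    and "metric T B"
  shows "good_metric T (improvement T B)"
proof -
  interpret triangulated_category T by fact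
  let ?C = "improvement T B"
  have closed: "ext_closed T (?C n)" and dec: "?C (n + 1) \<subseteq> ?C n"
    and good: "unshift_image T (?C (n + 1)) \<subseteq> ?C n" "shift_image T (?C (n + 1)) \<subseteq> ?C n"
    if "n \<ge> 1" for n
  proof -
    obtain m where n: "n = Suc m" using \<open>n \<ge> 1\<close> by (cases n) auto
    show cl: "ext_closed T (?C n)"
      unfolding n by (rule ext_closed_improvement[OF assms(2)])
    show "?C (n + 1) \<subseteq> ?C n"
      using improvement_decreasing[OF assms(2)] n by simp
    have "?C (n + 1) \<subseteq> shift_image T (?C n)" "?C (n + 1) \<subseteq> unshift_image T (?C n)"
      by (auto simp: n)
    from unshift_image_mono[OF this(1), of T] shift_image_mono[OF this(2), of T]
    show "unshift_image T (?C (n + 1)) \<subseteq> ?C n" "shift_image T (?C (n + 1)) \<subseteq> ?C n"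
      using unshift_image_shift_image_subset[OF cl] shift_image_unshift_image_subset[OF cl]
      by blast+
  qed
  have "metric T ?C"
    unfolding metric_def
    using closed dec ext_closed_ext_product by (auto simp: ext_closed_def)
  with dec good show ?thesis unfolding good_metric_def by blast
qed

end
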